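(* Let $N\in\mathbb N$, $R_x\ge0$, let $\mathcal F(\mathbb R^d)$ be a class of closed, convex and proper functions whose interpolation conditions are encoded by $\{(A^{\mathrm{ic}}_k,a^{\mathrm{ic}}_k,b^{\mathrm{ic}}_k)\}_{k\in K_N}$, and let $(\{\tilde\alpha_k\},\{\tilde\beta_{i,j}\},\{\tilde\gamma_{i,j}\},\tilde\tau_x)$ be a feasible solution to problem (D) (defined in the context) that attains the objective value $\tilde\omega$ and satisfies $\tilde\gamma_{i,i}\ne0$ for $i=1,\dots,N$. Then for any $(\mathcal F(\mathbb R^d),R_x)$-input $(f,x_0)$, if $\{x_i\}$ is defined by $$x_i=x_0-\sum_{j=1}^{i-1}\frac{\tilde\gamma_{i,j}}{\tilde\gamma_{i,i}}(x_j-x_0)-\sum_{j=0}^{i-1}\frac{\tilde\beta_{i,j}}{\tilde\gamma_{i,i}}f'(x_j),\qquad i=1,\dots,N,$$ then the bound $f(x_N)-f_*\le\tilde\omega$ holds for any choice of $f'(x_i)\in\partial f(x_i)$.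
   Context: $\langle\cdot,\cdot\rangle$ and $\|\cdot\|$ are the Euclidean inner product and norm; $\mathbb N$ denotes the positive integers; $I^*_N:=\{*,0,1,\dots,N\}$; $f_*:=\min f$. $x\odot y:=\tfrac12(xy^\top+yx^\top)$. For a square matrix $M$, $M\succeq0$ means $v^\top Mv\ge0$ for all $v$. The subgradients $f'(x_i)\in\partial f(x_i)$, $0\le i\le N$, are assumed to exist at the iterates. $(f,x_0)$ is an $(\mathcal F(\mathbb R^d),R_x)$-input if $f\in\mathcal F(\mathbb R^d)$, $x_0\in\mathbb R^d$, and $\|x_0-x_*\|\le R_x$ for some $x_*\in\operatorname{argmin}f$. A set $\{(x_i,g_i,f_i)\}_{i\in I}$ is $\mathcal F(\mathbb R^d)$-interpolable if there is $f\in\mathcal F(\mathbb R^d)$ with $g_i\in\partial f(x_i)$ and $f_i=f(x_i)$ for all $i\in I$. With $e_k$ the canonical unit vectors, $\mathbf x_i,\mathbf g_i\in\mathbb R^{2N+2}$ and $\mathbf f_i\in\mathbb R^{N+2}$ are: $\mathbf x_0=0$, $\mathbf x_i=e_{N+1+i}$ ($1\le i\le N$), $\mathbf x_*=e_{2N+2}$, $\mathbf g_*=0$, $\mathbf g_i=e_{i+1}$ ($0\le i\le N$), $\mathbf f_i=e_{i+1}$ ($0\le i\le N$), $\mathbf f_*=e_{N+2}$. Encoding: $K_N$ is a finite index set, $A^{\mathrm{ic}}_k\in\mathbb R^{(2N+2)\times(2N+2)}$, $a^{\mathrm{ic}}_k\in\mathbb R^{N+2}$, $b^{\mathrm{ic}}_k\in\mathbb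 R$; they encode the interpolation conditions for $\mathcal F(\mathbb R^d)$ if, for any set $\{(x_i,g_i,f_i)\}_{i\in I^*_N}$ with $g_*=0$, setting $P=[g_0,\dots,g_N,\,x_1-x_0,\dots,x_N-x_0,\,x_*-x_0]$, $G=P^\top P$ and $F=[f_0,\dots,f_N,f_*]^\top$, the set is $\mathcal F(\mathbb R^d)$-interpolable if and only if $\mathrm{Tr}(A^{\mathrm{ic}}_kG)+(a^{\mathrm{ic}}_k)^\top F+b^{\mathrm{ic}}_k\le0$ for all $k\in K_N$. Problem (D): $$\begin{aligned}\inf\ &\ \tau_xR_x^2-\sum_{k\in K_N}\alpha_k b^{\mathrm{ic}}_k\\ \text{subject to: }&\ \alpha_k\ge 0,\quad \tau_x\ge 0,\\ &\ \sum_{k\in K_N}\alpha_kA^{\mathrm{ic}}_k+\sum_{i=1}^N \mathbf g_i\odot\Big[\sum_{j=0}^{i-1}\beta_{i,j}\mathbf g_j+\sum_{j=1}^{i}\gamma_{i,j}(\mathbf x_j-\mathbf x_0)\Big]+\tau_x\,(\mathbf x_0-\mathbf x_* )\odot(\mathbf x_0-\mathbf x_* )\succeq 0,\\ &\ \mathbf f_N-\mathbf f_*-\sum_{k\in K_N}\alpha_ka^{\mathrm{ic}}_k=0,\end{aligned}$$ with real variables $\alpha_k$ ($k\in K_N$), $\beta_{i,j}$ ($1\le i\le N$, $0\le j\le i-1$), $\gamma_{i,j}$ ($1\le i\le N$, $1\le j\le i$), $\tau_x$. *)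

theory Defs
  imports "HOL-Analysis.Analysis" "Jordan_Normal_Form.Matrix"
begin

text \<open>
  Points live in \<^typ>\<open>real^'d\<close>. The matrices and vectors whose size depends on \<open>N\<close> are those of
  \<^theory>\<open>Jordan_Normal_Form.Matrix\<close>, whose indices start at \<open>0\<close>; the unit vector \<open>e\<^sub>k\<close> of the
  usual 1-based numbering is therefore \<^term>\<open>unit_vec n (k - 1)\<close>.
\<close>

unbundle no vec_syntax and no inner_syntax

section \<open>Extended-valued convex functions\<close>

definition ereal_epigraph :: "('a \<Rightarrow> ereal) \<Rightarrow> ('a \<times> real) set" where
  "ereal_epigraph f = {(x, t). f x \<le> ereal t}"

definition closed_fun :: "('a::topological_space \<Rightarrow> ereal) \<Rightarrow> bool" where
  "closed_fun f \<longleftrightarrow> closed (ereal_epigraph f)"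

definition convex_fun :: "('a::real_vector \<Rightarrow> ereal) \<Rightarrow> bool" where
  "convex_fun f \<longleftrightarrow> convex (ereal_epigraph f)"

definition proper_fun :: "('a \<Rightarrow> ereal) \<Rightarrow> bool" where
  "proper_fun f \<longleftrightarrow> (\<forall>x. f x \<noteq> -\<infinity>) \<and> (\<exists>x. f x \<noteq> \<infinity>)"

text \<open>For proper \<open>f\<close> the set below is empty at points where \<open>f\<close> is \<open>\<infinity>\<close>.\<close>

definition subdifferential :: "('a::real_inner \<Rightarrow> ereal) \<Rightarrow> 'a \<Rightarrow> 'a set" where
  "subdifferential f x = {g. \<forall>y. f x + ereal (inner g (y - x)) \<le> f y}"

definition argmin :: "('a \<Rightarrow> ereal) \<Rightarrow> 'a set" where
  "argmin f = {x. is_arg_min f (\<lambda>_. True) x}"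

text \<open>This is the minimum of \<open>f\<close> whenever \<^term>\<open>argmin f\<close> is nonempty.\<close>

definition min_value :: "('a \<Rightarrow> ereal) \<Rightarrow> ereal" where
  "min_value f = (INF x. f x)"

definition is_input :: "('a::real_normed_vector \<Rightarrow> ereal) set \<Rightarrow> real \<Rightarrow> ('a \<Rightarrow> ereal) \<Rightarrow> 'a \<Rightarrow> bool" where
  "is_input \<F> R f x0 \<longleftrightarrow> f \<in> \<F> \<and> (\<exists>xs\<in>argmin f. norm (x0 - xs) \<le> R)"

definition interpolable ::
    "('a::real_inner \<Rightarrow> ereal) set \<Rightarrow> 'i set \<Rightarrow> ('i \<Rightarrow> 'a) \<Rightarrow> ('i \<Rightarrow> 'a) \<Rightarrow> ('i \<Rightarrow> real) \<Rightarrow> bool" where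
  "interpolable \<F> I x g fv \<longleftrightarrow>
     (\<exists>f\<in>\<F>. \<forall>i\<in>I. g i \<in> subdifferential f (x i) \<and> ereal (fv i) = f (x i))"

section \<open>Matrix notions\<close>

definition mat_trace :: "real Matrix.mat \<Rightarrow> real" where
  "mat_trace M = (\<Sum>i<dim_row M. M $$ (i, i))"

text \<open>Positive semidefiniteness does not include symmetry.\<close>

definition psd :: "real Matrix.mat \<Rightarrow> bool" where
  "psd M \<longleftrightarrow> (\<forall>v\<in>carrier_vec (dim_row M). 0 \<le> v \<bullet> (M *\<^sub>v v))"

definition outer_prod :: "real Matrix.vec \<Rightarrow> real Matrix.vec \<Rightarrow> real Matrix.mat" where
  "outer_prod x y = Matrix.mat (dim_vec x) (dim_vec y) (\<lambda>(i, j). x $ i * y $ j)"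

definition sym_prod :: "real Matrix.vec \<Rightarrow> real Matrix.vec \<Rightarrow> real Matrix.mat" (infixl \<open>\<odot>\<close> 70) where
  "x \<odot> y = (1/2) \<cdot>\<^sub>m (outer_prod x y + outer_prod y x)"

abbreviation vsum :: "nat \<Rightarrow> ('i \<Rightarrow> real Matrix.vec) \<Rightarrow> 'i set \<Rightarrow> real Matrix.vec" where
  "vsum \<equiv> finsum_vec TYPE(real)"

abbreviation msum :: "nat \<Rightarrow> ('i \<Rightarrow> real Matrix.mat) \<Rightarrow> 'i set \<Rightarrow> real Matrix.mat" where
  "msum n \<equiv> finsum (module_mat TYPE(real) n n)"

text \<open>\<open>P\<^sup>T P\<close> for the matrix \<open>P\<close> with the given list of columns.\<close>

definition gram :: "'a::real_inner list \<Rightarrow> real Matrix.mat" where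
  "gram P = Matrix.mat (length P) (length P) (\<lambda>(i, j). inner (P ! i) (P ! j))"

section \<open>Interpolation data and their encoding\<close>

datatype idx = Star | It nat

definition idx_set :: "nat \<Rightarrow> idx set" where
  "idx_set N = insert Star (It ` {0..N})"

fun bx :: "nat \<Rightarrow> idx \<Rightarrow> real Matrix.vec" where
  "bx N Star = unit_vec (2*N+2) (2*N+1)"
| "bx N (It i) = (if i = 0 then 0\<^sub>v (2*N+2) else unit_vec (2*N+2) (N+i))"

fun bg :: "nat \<Rightarrow> idx \<Rightarrow> real Matrix.vec" where
  "bg N Star = 0\<^sub>v (2*N+2)"
| "bg N (It i) = unit_vec (2*N+2) i"

fun bf :: "nat \<Rightarrow> idx \<Rightarrow> real Matrix.vec" where
  "bf N Star = unit_vec (N+2) (N+1)"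
| "bf N (It i) = unit_vec (N+2) i"

definition P_cols :: "nat \<Rightarrow> (idx \<Rightarrow> 'a::real_vector) \<Rightarrow> (idx \<Rightarrow> 'a) \<Rightarrow> 'a list" where
  "P_cols N x g = map (\<lambda>i. g (It i)) [0..<N+1]
     @ map (\<lambda>i. x (It i) - x (It 0)) [1..<N+1] @ [x Star - x (It 0)]"

definition F_vec :: "nat \<Rightarrow> (idx \<Rightarrow> real) \<Rightarrow> real Matrix.vec" where
  "F_vec N fv = vec_of_list (map (\<lambda>i. fv (It i)) [0..<N+1] @ [fv Star])"

definition encodes_interpolation ::
    "nat \<Rightarrow> (real^'d \<Rightarrow> ereal) set \<Rightarrow> 'k set \<Rightarrow> ('k \<Rightarrow> real Matrix.mat) \<Rightarrow> ('k \<Rightarrow> real Matrix.vec)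
      \<Rightarrow> ('k \<Rightarrow> real) \<Rightarrow> bool" where
  "encodes_interpolation N \<F> K A a b \<longleftrightarrow>
     finite K \<and>
     (\<forall>k\<in>K. A k \<in> carrier_mat (2*N+2) (2*N+2) \<and> a k \<in> carrier_vec (N+2)) \<and>
     (\<forall>x g fv. g Star = 0 \<longrightarrow>
        (interpolable \<F> (idx_set N) x g fv \<longleftrightarrow>
         (\<forall>k\<in>K. mat_trace (A k * gram (P_cols N x g)) + a k \<bullet> F_vec N fv + b k \<le> 0)))"

section \<open>The dual problem\<close>

definition D_objective ::
    "real \<Rightarrow> 'k set \<Rightarrow> ('k \<Rightarrow> real) \<Rightarrow> ('k \<Rightarrow> real) \<Rightarrow> real \<Rightarrow> real" where
  "D_objective R K b \<alpha> \<tau> = \<tau> * R\<^sup>2 - (\<Sum>k\<in>K. \<alpha> k * b k)"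

definition D_matrix ::
    "nat \<Rightarrow> 'k set \<Rightarrow> ('k \<Rightarrow> real Matrix.mat) \<Rightarrow> ('k \<Rightarrow> real) \<Rightarrow> (nat \<Rightarrow> nat \<Rightarrow> real)
      \<Rightarrow> (nat \<Rightarrow> nat \<Rightarrow> real) \<Rightarrow> real \<Rightarrow> real Matrix.mat" where
  "D_matrix N K A \<alpha> \<beta> \<gamma> \<tau> =
     msum (2*N+2) (\<lambda>k. \<alpha> k \<cdot>\<^sub>m A k) K
     + msum (2*N+2) (\<lambda>i. bg N (It i) \<odot>
         (vsum (2*N+2) (\<lambda>j. \<beta> i j \<cdot>\<^sub>v bg N (It j)) {0..<i}
          + vsum (2*N+2) (\<lambda>j. \<gamma> i j \<cdot>\<^sub>v (bx N (It j) - bx N (It 0))) {1..i})) {1..N}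
     + \<tau> \<cdot>\<^sub>m ((bx N (It 0) - bx N Star) \<odot> (bx N (It 0) - bx N Star))"

definition D_feasible ::
    "nat \<Rightarrow> 'k set \<Rightarrow> ('k \<Rightarrow> real Matrix.mat) \<Rightarrow> ('k \<Rightarrow> real Matrix.vec) \<Rightarrow> ('k \<Rightarrow> real)
      \<Rightarrow> (nat \<Rightarrow> nat \<Rightarrow> real) \<Rightarrow> (nat \<Rightarrow> nat \<Rightarrow> real) \<Rightarrow> real \<Rightarrow> bool" where
  "D_feasible N K A a \<alpha> \<beta> \<gamma> \<tau> \<longleftrightarrow>
     (\<forall>k\<in>K. 0 \<le> \<alpha> k) \<and> 0 \<le> \<tau> \<and>
     psd (D_matrix N K A \<alpha> \<beta> \<gamma> \<tau>) \<and>
     bf N (It N) - bf N Star - vsum (N+2) (\<lambda>k. \<alpha> k \<cdot>\<^sub>v a k) K = 0\<^sub>v (N+2)"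

end

theory Submission
  imports Defs
begin

text \<open>
  The bound is weak duality. Take a minimizer \<open>x\<^sub>*\<close> within distance \<open>R\<^sub>x\<close> of \<open>x\<^sub>0\<close> and let \<open>G\<close> be the
  Gram matrix of the vectors \<open>g\<^sub>i\<close>, \<open>x\<^sub>i - x\<^sub>0\<close>, \<open>x\<^sub>* - x\<^sub>0\<close> produced by the run. Since \<open>f\<close> itself
  interpolates the data, each encoded inequality \<open>Tr (A\<^sub>k G) + a\<^sub>k\<^sup>T F + b\<^sub>k \<le> 0\<close> holds. Weighting these
  by \<open>\<alpha>\<^sub>k \<ge> 0\<close>, adding them, and using the linear constraint \<open>f\<^sub>N - f\<^sub>* = (\<Sum>k. \<alpha>\<^sub>k a\<^sub>k)\<^sup>T F\<close> gives
  \<open>f\<^sub>N - f\<^sub>* \<le> - (\<Sum>k. \<alpha>\<^sub>k b\<^sub>k) - (\<Sum>k. \<alpha>\<^sub>k Tr (A\<^sub>k G))\<close>.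

  The last sum is controlled by pairing the semidefinite constraint with \<open>G\<close>. The trace of a positive
  semidefinite matrix against a Gram matrix is nonnegative (\<open>trace_gram_nonneg\<close>), and the trace of
  \<open>u \<odot> v\<close> against \<open>G\<close> is the inner product of the two vectors with coordinates \<open>u\<close> and \<open>v\<close>
  (\<open>trace_gram_sym_prod\<close>). Hence the terms with \<open>\<beta>\<close> and \<open>\<gamma>\<close> become
  \<open>\<langle>g\<^sub>i, (\<Sum>j<i. \<beta>\<^sub>i\<^sub>j g\<^sub>j) + (\<Sum>j=1..i. \<gamma>\<^sub>i\<^sub>j (x\<^sub>j - x\<^sub>0))\<rangle>\<close>. The recursion defining the method, multiplied by
  \<open>\<gamma>\<^sub>i\<^sub>i \<noteq> 0\<close>, says that the second argument is zero, so only \<open>\<tau> \<parallel>x\<^sub>0 - x\<^sub>*\<parallel>\<^sup>2 \<le> \<tau> R\<^sub>x\<^sup>2\<close> remains besides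
  the sum in question, which is therefore at least \<open>- \<tau> R\<^sub>x\<^sup>2\<close>.
\<close>

section \<open>Pairing matrices with a Gram matrix\<close>

text \<open>The matrix-vector product \<open>P v\<close>, where \<open>P\<close> is given by its list of columns.\<close>

definition cols_mult :: "'a::real_vector list \<Rightarrow> real Matrix.vec \<Rightarrow> 'a" where
  "cols_mult P v = (\<Sum>i<length P. (v $ i) *\<^sub>R P ! i)"

lemma gram_carrier [simp]: "length P = n \<Longrightarrow> gram P \<in> carrier_mat n n"
  by (simp add: gram_def)

lemma trace_gram:
  assumes "M \<in> carrier_mat n n" and "length P = n"
  shows "mat_trace (M * gram P) = (\<Sum>i<n. \<Sum>j<n. M $$ (i, j) * inner (P ! i) (P ! j))"
  using assms
  by (auto simp: mat_trace_def gram_def scalar_prod_def atLeast0LessThan inner_commute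
      intro!: sum.cong)

text \<open>
  In an orthonormal basis the Gram matrix is the sum over the basis vectors \<open>e\<close> of \<open>w\<^sub>e w\<^sub>e\<^sup>T\<close>, where
  \<open>w\<^sub>e\<close> lists the \<open>e\<close>-coordinates of the columns; the trace is thus a sum of values of the quadratic
  form of \<open>M\<close>.
\<close>

lemma trace_gram_nonneg:
  fixes P :: "'a::euclidean_space list"
  assumes M: "M \<in> carrier_mat n n" and P: "length P = n" and "psd M"
  shows "0 \<le> mat_trace (M * gram P)"
proof -
  define w where "w e = Matrix.vec n (\<lambda>i. inner (P ! i) e)" for e
  have "mat_trace (M * gram P) =
      (\<Sum>i<n. \<Sum>j<n. \<Sum>e\<in>Basis. inner (P ! i) e * (M $$ (i, j) * inner (P ! j) e))"
    unfolding trace_gram[OF M P]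
    by (subst euclidean_inner) (simp add: sum_distrib_left mult_ac)
  also have "\<dots> = (\<Sum>i<n. \<Sum>e\<in>Basis. \<Sum>j<n. inner (P ! i) e * (M $$ (i, j) * inner (P ! j) e))"
    by (intro sum.cong refl sum.swap)
  also have "\<dots> = (\<Sum>e\<in>Basis. \<Sum>i<n. \<Sum>j<n. inner (P ! i) e * (M $$ (i, j) * inner (P ! j) e))"
    by (rule sum.swap)
  also have "\<dots> = (\<Sum>e\<in>Basis. w e \<bullet> (M *\<^sub>v w e))"
    using M by (intro sum.cong refl)
      (simp add: w_def scalar_prod_def atLeast0LessThan sum_distrib_left)
  also have "\<dots> \<ge> 0"
    using M \<open>psd M\<close> by (intro sum_nonneg) (auto simp: psd_def w_def)
  finally show ?thesis .
qed

lemma trace_gram_add: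
  assumes "A \<in> carrier_mat n n" and "B \<in> carrier_mat n n" and "length P = n"
  shows "mat_trace ((A + B) * gram P) = mat_trace (A * gram P) + mat_trace (B * gram P)"
  using assms by (simp add: trace_gram[of _ n] distrib_right sum.distrib)

lemma trace_gram_smult:
  assumes "A \<in> carrier_mat n n" and "length P = n"
  shows "mat_trace ((c \<cdot>\<^sub>m A) * gram P) = c * mat_trace (A * gram P)"
  using assms by (simp add: trace_gram[of _ n] sum_distrib_left mult.assoc)

lemma msum_closed:
  assumes "\<And>i. i \<in> I \<Longrightarrow> A i \<in> carrier_mat n n"
  shows "msum n A I \<in> carrier_mat n n"
proof -
  interpret abelian_group "module_mat TYPE(real) n n" by (rule abelian_group_mat)
  show ?thesis
    using finsum_closed[of A I] assms by (auto simp: module_mat_simps)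
qed

lemma trace_gram_msum:
  assumes "finite I" and "\<And>i. i \<in> I \<Longrightarrow> A i \<in> carrier_mat n n" and P: "length P = n"
  shows "mat_trace (msum n A I * gram P) = (\<Sum>i\<in>I. mat_trace (A i * gram P))"
  using assms(1,2)
proof (induction I)
  case empty
  interpret abelian_group "module_mat TYPE(real) n n" by (rule abelian_group_mat)
  show ?case
    by (simp add: module_mat_simps trace_gram[OF zero_carrier_mat P])
next
  case (insert i I)
  interpret abelian_group "module_mat TYPE(real) n n" by (rule abelian_group_mat)
  have "msum n A (insert i I) = A i + msum n A I"
    using insert finsum_insert[of I i A] by (auto simp: module_mat_simps)
  then show ?case
    using insert P by (simp add: trace_gram_add[of _ n] msum_closed)
qed

lemma sym_prod_carrier [simp]:
  "u \<in> carrier_vec n \<Longrightarrow> v \<in> carrier_vec n \<Longrightarrow> u \<odot> v \<in> carrier_mat n n"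
  by (auto simp: sym_prod_def outer_prod_def)

lemma trace_gram_sym_prod:
  assumes u: "u \<in> carrier_vec n" and v: "v \<in> carrier_vec n" and P: "length P = n"
  shows "mat_trace ((u \<odot> v) * gram P) = inner (cols_mult P u) (cols_mult P v)"
proof -
  have outer: "mat_trace (outer_prod p q * gram P) = inner (cols_mult P p) (cols_mult P q)"
    if "p \<in> carrier_vec n" "q \<in> carrier_vec n" for p q
  proof -
    have "outer_prod p q \<in> carrier_mat n n"
      using that by (auto simp: outer_prod_def)
    then show ?thesis
      using that P unfolding cols_mult_def
      by (subst inner_sum_left)
        (simp add: trace_gram[of _ n] outer_prod_def inner_sum_right sum_distrib_left mult_ac)
  qed
  have carr: "outer_prod u v \<in> carrier_mat n n" "outer_prod v u \<in> carrier_mat n n"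
    using u v by (auto simp: outer_prod_def)
  show ?thesis
    using carr u v P
    by (simp add: sym_prod_def trace_gram_smult[of _ n] trace_gram_add[of _ n] outer inner_commute)
qed

section \<open>Coordinates of the run\<close>

lemma cols_mult_unit:
  assumes "length P = n" and "i < n"
  shows "cols_mult P (unit_vec n i) = P ! i"
proof -
  have "cols_mult P (unit_vec n i) = (\<Sum>j<n. if j = i then P ! j else 0)"
    unfolding cols_mult_def using assms by (intro sum.cong) auto
  then show ?thesis using assms by simp
qed

lemma cols_mult_zero: "length P = n \<Longrightarrow> cols_mult P (0\<^sub>v n) = 0"
  by (simp add: cols_mult_def)

lemma cols_mult_add:
  assumes "u \<in> carrier_vec n" and "v \<in> carrier_vec n" and "length P = n"
  shows "cols_mult P (u + v) = cols_mult P u + cols_mult P v"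
  using assms by (simp add: cols_mult_def scaleR_add_left sum.distrib)

lemma cols_mult_diff:
  assumes "u \<in> carrier_vec n" and "v \<in> carrier_vec n" and "length P = n"
  shows "cols_mult P (u - v) = cols_mult P u - cols_mult P v"
  using assms by (simp add: cols_mult_def scaleR_diff_left sum_subtractf)

lemma cols_mult_smult:
  assumes "u \<in> carrier_vec n" and "length P = n"
  shows "cols_mult P (c \<cdot>\<^sub>v u) = c *\<^sub>R cols_mult P u"
  using assms by (simp add: cols_mult_def scaleR_sum_right)

lemma cols_mult_vsum:
  assumes "finite I" and "\<And>i. i \<in> I \<Longrightarrow> u i \<in> carrier_vec n" and "length P = n"
  shows "cols_mult P (vsum n u I) = (\<Sum>i\<in>I. cols_mult P (u i))"
proof -
  have "cols_mult P (vsum n u I) = (\<Sum>j<n. \<Sum>i\<in>I. (u i $ j) *\<^sub>R P ! j)"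
    using assms by (simp add: cols_mult_def index_finsum_vec Pi_def scaleR_sum_left)
  also have "\<dots> = (\<Sum>i\<in>I. \<Sum>j<n. (u i $ j) *\<^sub>R P ! j)"
    by (rule sum.swap)
  finally show ?thesis
    using assms by (simp add: cols_mult_def)
qed

lemma vsum_closed:
  "(\<And>i. i \<in> I \<Longrightarrow> u i \<in> carrier_vec n) \<Longrightarrow> vsum n u I \<in> carrier_vec n"
  by (rule finsum_vec_closed) auto

lemma vsum_scalar_prod:
  assumes "finite I" and u: "\<And>i. i \<in> I \<Longrightarrow> u i \<in> carrier_vec n" and v: "v \<in> carrier_vec n"
  shows "vsum n u I \<bullet> v = (\<Sum>i\<in>I. u i \<bullet> v)"
proof -
  have "vsum n u I \<bullet> v = (\<Sum>j<n. \<Sum>i\<in>I. u i $ j * v $ j)"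
    using assms
    by (simp add: scalar_prod_def atLeast0LessThan index_finsum_vec Pi_def sum_distrib_right)
  also have "\<dots> = (\<Sum>i\<in>I. \<Sum>j<n. u i $ j * v $ j)"
    by (rule sum.swap)
  finally show ?thesis
    using v by (simp add: scalar_prod_def atLeast0LessThan)
qed

lemma length_P_cols [simp]: "length (P_cols N x g) = 2*N+2"
  by (simp add: P_cols_def)

lemma bg_carrier [simp]: "bg N i \<in> carrier_vec (2*N+2)"
  by (cases i) simp_all

lemma bx_carrier [simp]: "bx N i \<in> carrier_vec (2*N+2)"
  by (cases i) simp_all

lemma bf_carrier [simp]: "bf N i \<in> carrier_vec (N+2)"
  by (cases i) simp_all

lemma F_vec_carrier [simp]: "F_vec N fv \<in> carrier_vec (N+2)"
  by (rule carrier_vecI) (simp add: F_vec_def)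

lemma P_cols_nth:
  "i \<le> N \<Longrightarrow> P_cols N x g ! i = g (It i)"
  "1 \<le> i \<Longrightarrow> i \<le> N \<Longrightarrow> P_cols N x g ! (N + i) = x (It i) - x (It 0)"
  "P_cols N x g ! (2*N+1) = x Star - x (It 0)"
  by (auto simp: P_cols_def nth_append simp del: upt_Suc)

text \<open>
  The vectors \<open>\<^bold>g\<^sub>i\<close>, \<open>\<^bold>x\<^sub>i\<close> are symbols for the data: \<open>P\<close> sends them to the actual subgradients and
  displacements, so the symbolic products in the dual constraint evaluate to inner products of the run.
\<close>

lemma cols_mult_bg:
  assumes "i \<le> N"
  shows "cols_mult (P_cols N x g) (bg N (It i)) = g (It i)"
  using assms by (simp add: cols_mult_unit P_cols_nth(1))

lemma cols_mult_bx:
  assumes "i \<in> idx_set N"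
  shows "cols_mult (P_cols N x g) (bx N i) = x i - x (It 0)"
proof (cases i)
  case Star
  then show ?thesis
    using P_cols_nth(3)[of N x g] by (simp add: cols_mult_unit)
next
  case (It k)
  show ?thesis
  proof (cases "k = 0")
    case True
    with It show ?thesis by (simp add: cols_mult_zero)
  next
    case False
    with It assms show ?thesis
      using P_cols_nth(2)[of k N x g]
      by (auto simp: cols_mult_unit idx_set_def)
  qed
qed

lemma bf_F_vec:
  assumes "i \<in> idx_set N"
  shows "bf N i \<bullet> F_vec N fv = fv i"
proof -
  have "bf N i \<bullet> F_vec N fv = F_vec N fv $ (case i of Star \<Rightarrow> N+1 | It k \<Rightarrow> k)"
    using assms scalar_prod_left_unit[OF F_vec_carrier]
    by (auto simp: idx_set_def)
  also have "\<dots> = fv i"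
    using assms by (auto simp: idx_set_def F_vec_def vec_of_list_index nth_append simp del: upt_Suc)
  finally show ?thesis .
qed

text \<open>
  From here on the symbols are used only through their images, so they must not be rewritten to unit
  vectors.
\<close>

declare bx.simps [simp del] bg.simps [simp del] bf.simps [simp del]

section \<open>Weak duality\<close>

text \<open>
  The terms with \<open>\<beta>\<close> and \<open>\<gamma>\<close> contribute to the trace exactly the inner products in the last
  hypothesis, so they disappear for any data satisfying these orthogonality relations.
\<close>

lemma trace_D_matrix:
  assumes "finite K" and A: "\<And>k. k \<in> K \<Longrightarrow> A k \<in> carrier_mat (2*N+2) (2*N+2)"
    and orth: "\<And>i. i \<in> {1..N} \<Longrightarrow>
      inner (g (It i)) ((\<Sum>j\<in>{0..<i}. \<beta> i j *\<^sub>R g (It j))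
        + (\<Sum>j\<in>{1..i}. \<gamma> i j *\<^sub>R (x (It j) - x (It 0)))) = 0"
  shows "mat_trace (D_matrix N K A \<alpha> \<beta> \<gamma> \<tau> * gram (P_cols N x g)) =
    (\<Sum>k\<in>K. \<alpha> k * mat_trace (A k * gram (P_cols N x g))) + \<tau> * (norm (x (It 0) - x Star))\<^sup>2"
proof -
  define n where "n = 2*N+2"
  define P where "P = P_cols N x g"
  have P: "length P = n" by (simp add: P_def n_def)
  have bg: "bg N i \<in> carrier_vec n" and bx: "bx N i \<in> carrier_vec n" for i
    unfolding n_def by (rule bg_carrier bx_carrier)+
  have bxd: "bx N i - bx N j \<in> carrier_vec n" for i j
    using bx by simp
  have An: "A k \<in> carrier_mat n n" if "k \<in> K" for k using A that by (simp add: n_def)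
  define s where "s i = vsum n (\<lambda>j. \<beta> i j \<cdot>\<^sub>v bg N (It j)) {0..<i}" for i
  define t where "t i = vsum n (\<lambda>j. \<gamma> i j \<cdot>\<^sub>v (bx N (It j) - bx N (It 0))) {1..i}" for i
  have s: "s i \<in> carrier_vec n" and t: "t i \<in> carrier_vec n" for i
    unfolding s_def t_def by (intro vsum_closed smult_carrier_vec[THEN iffD2] bg bxd)+
  have bxP: "cols_mult P (bx N i - bx N j) = x i - x j" if "i \<in> idx_set N" "j \<in> idx_set N" for i j
    using that bx P by (simp add: cols_mult_diff[of _ n]) (simp add: P_def cols_mult_bx)
  have sP: "cols_mult P (s i) = (\<Sum>j\<in>{0..<i}. \<beta> i j *\<^sub>R g (It j))" if "i \<le> N" for i
  proof -
    have "cols_mult P (s i) = (\<Sum>j\<in>{0..<i}. \<beta> i j *\<^sub>R cols_mult P (bg N (It j)))"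
      unfolding s_def
      by (subst cols_mult_vsum) (simp_all add: P bg cols_mult_smult[of _ n])
    also have "\<dots> = (\<Sum>j\<in>{0..<i}. \<beta> i j *\<^sub>R g (It j))"
      using that by (intro sum.cong refl) (simp add: P_def cols_mult_bg)
    finally show ?thesis .
  qed
  have tP: "cols_mult P (t i) = (\<Sum>j\<in>{1..i}. \<gamma> i j *\<^sub>R (x (It j) - x (It 0)))" if "i \<le> N" for i
  proof -
    have "cols_mult P (t i) = (\<Sum>j\<in>{1..i}. \<gamma> i j *\<^sub>R cols_mult P (bx N (It j) - bx N (It 0)))"
      unfolding t_def
      by (subst cols_mult_vsum) (simp_all add: P bxd cols_mult_smult[of _ n])
    also have "\<dots> = (\<Sum>j\<in>{1..i}. \<gamma> i j *\<^sub>R (x (It j) - x (It 0)))"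
      using that by (intro sum.cong refl) (subst bxP, auto simp: idx_set_def)
    finally show ?thesis .
  qed
  have mid: "mat_trace ((bg N (It i) \<odot> (s i + t i)) * gram P) = 0" if "i \<in> {1..N}" for i
  proof -
    have "mat_trace ((bg N (It i) \<odot> (s i + t i)) * gram P)
        = inner (cols_mult P (bg N (It i))) (cols_mult P (s i) + cols_mult P (t i))"
      using bg s t P by (simp add: trace_gram_sym_prod[of _ n] cols_mult_add[of _ n])
    also have "cols_mult P (bg N (It i)) = g (It i)"
      using that by (simp add: P_def cols_mult_bg)
    finally show ?thesis
      using that orth[of i] sP tP by simp
  qed
  define d where "d = bx N (It 0) - bx N Star"
  have d: "d \<in> carrier_vec n" unfolding d_def by (rule bxd)
  have dP: "cols_mult P d = x (It 0) - x Star"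
    unfolding d_def by (rule bxP) (auto simp: idx_set_def)
  have D: "D_matrix N K A \<alpha> \<beta> \<gamma> \<tau> =
      msum n (\<lambda>k. \<alpha> k \<cdot>\<^sub>m A k) K + msum n (\<lambda>i. bg N (It i) \<odot> (s i + t i)) {1..N} + \<tau> \<cdot>\<^sub>m (d \<odot> d)"
    by (simp only: D_matrix_def s_def t_def d_def n_def)
  have c1: "msum n (\<lambda>k. \<alpha> k \<cdot>\<^sub>m A k) K \<in> carrier_mat n n"
    using An by (intro msum_closed) simp
  have c2: "msum n (\<lambda>i. bg N (It i) \<odot> (s i + t i)) {1..N} \<in> carrier_mat n n"
    using bg s t by (intro msum_closed sym_prod_carrier) simp_all
  have c3: "\<tau> \<cdot>\<^sub>m (d \<odot> d) \<in> carrier_mat n n"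
    using d by simp
  have t1: "mat_trace (msum n (\<lambda>k. \<alpha> k \<cdot>\<^sub>m A k) K * gram P) = (\<Sum>k\<in>K. \<alpha> k * mat_trace (A k * gram P))"
    using An P \<open>finite K\<close> by (simp add: trace_gram_msum trace_gram_smult[of _ n])
  have t2: "mat_trace (msum n (\<lambda>i. bg N (It i) \<odot> (s i + t i)) {1..N} * gram P) = 0"
    using bg s t P mid by (subst trace_gram_msum) simp_all
  have t3: "mat_trace (\<tau> \<cdot>\<^sub>m (d \<odot> d) * gram P) = \<tau> * (norm (x (It 0) - x Star))\<^sup>2"
    using d P by (simp add: trace_gram_smult[of _ n] trace_gram_sym_prod[of _ n] dP power2_norm_eq_inner)
  show ?thesis
    using c1 c2 c3 P t1 t2 t3
    by (simp add: D trace_gram_add[of _ n] flip: P_def)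
qed

text \<open>
  The weighted sum of the interpolation inequalities bounds \<open>f\<^sub>N - f\<^sub>*\<close> in terms of
  \<open>\<Sum>k. \<alpha>\<^sub>k Tr (A\<^sub>k G)\<close>, and semidefiniteness together with \<open>trace_D_matrix\<close> bounds that sum below.
\<close>

lemma D_feasible_bound:
  fixes x g :: "idx \<Rightarrow> 'a::euclidean_space"
  assumes "finite K" and A: "\<And>k. k \<in> K \<Longrightarrow> A k \<in> carrier_mat (2*N+2) (2*N+2)"
    and a: "\<And>k. k \<in> K \<Longrightarrow> a k \<in> carrier_vec (N+2)"
    and feas: "D_feasible N K A a \<alpha> \<beta> \<gamma> \<tau>"
    and ineq: "\<And>k. k \<in> K \<Longrightarrow>
      mat_trace (A k * gram (P_cols N x g)) + a k \<bullet> F_vec N fv + b k \<le> 0"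
    and orth: "\<And>i. i \<in> {1..N} \<Longrightarrow>
      inner (g (It i)) ((\<Sum>j\<in>{0..<i}. \<beta> i j *\<^sub>R g (It j))
        + (\<Sum>j\<in>{1..i}. \<gamma> i j *\<^sub>R (x (It j) - x (It 0)))) = 0"
    and dist: "norm (x (It 0) - x Star) \<le> R"
  shows "fv (It N) - fv Star \<le> D_objective R K b \<alpha> \<tau>"
proof -
  let ?G = "gram (P_cols N x g)" and ?F = "F_vec N fv"
  have \<alpha>: "\<And>k. k \<in> K \<Longrightarrow> 0 \<le> \<alpha> k" and \<tau>: "0 \<le> \<tau>" and psd: "psd (D_matrix N K A \<alpha> \<beta> \<gamma> \<tau>)"
    and lin: "bf N (It N) - bf N Star - vsum (N+2) (\<lambda>k. \<alpha> k \<cdot>\<^sub>v a k) K = 0\<^sub>v (N+2)"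
    using feas by (auto simp: D_feasible_def)
  have "fv (It N) - fv Star = (\<Sum>k\<in>K. \<alpha> k * (a k \<bullet> ?F))"
  proof -
    let ?S = "vsum (N+2) (\<lambda>k. \<alpha> k \<cdot>\<^sub>v a k) K"
    have S: "?S \<in> carrier_vec (N+2)" using a by (intro vsum_closed) simp
    have 1: "?S \<bullet> ?F = (\<Sum>k\<in>K. \<alpha> k * (a k \<bullet> ?F))"
      using a by (simp add: vsum_scalar_prod[OF \<open>finite K\<close> _ F_vec_carrier]
          smult_scalar_prod_distrib[OF _ F_vec_carrier] del: add_2_eq_Suc')
    have "(bf N (It N) - bf N Star - ?S) \<bullet> ?F = 0"
      unfolding lin by (rule scalar_prod_left_zero[OF F_vec_carrier])
    then have "bf N (It N) \<bullet> ?F - bf N Star \<bullet> ?F - ?S \<bullet> ?F = 0"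
      using S by (simp add: minus_scalar_prod_distrib[of _ "N+2"] del: add_2_eq_Suc')
    then show ?thesis
      using 1 by (simp add: bf_F_vec idx_set_def)
  qed
  also have "\<dots> \<le> (\<Sum>k\<in>K. \<alpha> k * (- b k - mat_trace (A k * ?G)))"
    using \<alpha> ineq by (intro sum_mono mult_left_mono) fastforce+
  also have "\<dots> = - (\<Sum>k\<in>K. \<alpha> k * b k) - (\<Sum>k\<in>K. \<alpha> k * mat_trace (A k * ?G))"
    by (simp add: right_diff_distrib sum_subtractf sum_negf)
  also have "\<dots> \<le> \<tau> * (norm (x (It 0) - x Star))\<^sup>2 - (\<Sum>k\<in>K. \<alpha> k * b k)"
  proof -
    have "D_matrix N K A \<alpha> \<beta> \<gamma> \<tau> \<in> carrier_mat (2*N+2) (2*N+2)"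
      unfolding D_matrix_def
      by (intro add_carrier_mat smult_carrier_mat sym_prod_carrier minus_carrier_vec bx_carrier)
    then have "0 \<le> mat_trace (D_matrix N K A \<alpha> \<beta> \<gamma> \<tau> * ?G)"
      by (rule trace_gram_nonneg[OF _ length_P_cols psd])
    also have "\<dots> = (\<Sum>k\<in>K. \<alpha> k * mat_trace (A k * ?G)) + \<tau> * (norm (x (It 0) - x Star))\<^sup>2"
      by (rule trace_D_matrix) (fact \<open>finite K\<close>, erule A, erule orth)
    finally show ?thesis by simp
  qed
  also have "\<dots> \<le> \<tau> * R\<^sup>2 - (\<Sum>k\<in>K. \<alpha> k * b k)"
    using \<tau> dist by (intro diff_right_mono mult_left_mono power_mono) auto
  finally show ?thesis
    by (simp add: D_objective_def)
qed

text \<open>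
  Clearing the denominator \<open>\<gamma>\<^sub>i\<^sub>i\<close> in the update rule: \<open>x\<^sub>i\<close> is chosen exactly so that this combination
  vanishes.
\<close>

lemma update_rule_imp_zero:
  fixes x g :: "nat \<Rightarrow> 'a::real_vector"
  assumes "1 \<le> i" and "c i \<noteq> 0"
    and "x i = x 0 - (\<Sum>j\<in>{1..<i}. (c j / c i) *\<^sub>R (x j - x 0)) - (\<Sum>j\<in>{0..<i}. (b j / c i) *\<^sub>R g j)"
  shows "(\<Sum>j\<in>{0..<i}. b j *\<^sub>R g j) + (\<Sum>j\<in>{1..i}. c j *\<^sub>R (x j - x 0)) = 0"
proof -
  have "c i *\<^sub>R (x i - x 0) = c i *\<^sub>R (- (\<Sum>j\<in>{1..<i}. (c j / c i) *\<^sub>R (x j - x 0))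
      - (\<Sum>j\<in>{0..<i}. (b j / c i) *\<^sub>R g j))"
    by (subst assms(3)) simp
  also have "\<dots> = - (\<Sum>j\<in>{1..<i}. c j *\<^sub>R (x j - x 0)) - (\<Sum>j\<in>{0..<i}. b j *\<^sub>R g j)"
    using assms(2) by (simp add: scaleR_diff_right scaleR_sum_right)
  finally have "c i *\<^sub>R (x i - x 0)
    = - (\<Sum>j\<in>{1..<i}. c j *\<^sub>R (x j - x 0)) - (\<Sum>j\<in>{0..<i}. b j *\<^sub>R g j)" .
  moreover have "{1..i} = insert i {1..<i}" using assms(1) by auto
  ultimately show ?thesis by simp
qed

text \<open>
  Comparing with a point where \<open>f\<close> is finite excludes \<open>\<infinity>\<close>; interpolation data are real-valued, so
  this is what makes the run an instance of them.
\<close>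

lemma subdifferential_finite:
  assumes "proper_fun f" and "g \<in> subdifferential f x"
  shows "\<bar>f x\<bar> \<noteq> \<infinity>"
proof -
  obtain y where "f y \<noteq> \<infinity>" using assms(1) by (auto simp: proper_fun_def)
  moreover have "f x + ereal (inner g (y - x)) \<le> f y"
    using assms(2) by (auto simp: subdifferential_def)
  ultimately have "f x \<noteq> \<infinity>" by auto
  then show ?thesis using assms(1) by (auto simp: proper_fun_def)
qed

lemma argmin_min_value:
  assumes "xs \<in> argmin f"
  shows "f xs = min_value f" and "0 \<in> subdifferential f xs"
proof -
  have le: "f xs \<le> f y" for y
    using assms by (auto simp: argmin_def is_arg_min_linorder)
  then show "f xs = min_value f"
    unfolding min_value_def by (intro antisym INF_greatest INF_lower) auto
  show "0 \<in> subdifferential f xs"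
    using le by (simp add: subdifferential_def zero_ereal_def[symmetric])
qed

theorem corollary1:
  fixes N :: nat and R\<^sub>x :: real
    and \<F> :: "(real^'d \<Rightarrow> ereal) set"
    and K :: "'k set"
    and A :: "'k \<Rightarrow> real Matrix.mat" and a :: "'k \<Rightarrow> real Matrix.vec" and b :: "'k \<Rightarrow> real"
    and \<alpha> :: "'k \<Rightarrow> real" and \<beta> \<gamma> :: "nat \<Rightarrow> nat \<Rightarrow> real" and \<tau> \<omega> :: real
    and f :: "real^'d \<Rightarrow> ereal" and x0 :: "real^'d" and x f' :: "nat \<Rightarrow> real^'d"
  assumes "N \<ge> 1" and "R\<^sub>x \<ge> 0"
    and "\<forall>h\<in>\<F>. closed_fun h \<and> convex_fun h \<and> proper_fun h"
    and "encodes_interpolation N \<F> K A a b"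
    and "D_feasible N K A a \<alpha> \<beta> \<gamma> \<tau>"
    and "D_objective R\<^sub>x K b \<alpha> \<tau> = \<omega>"
    and "\<forall>i\<in>{1..N}. \<gamma> i i \<noteq> 0"
    and "is_input \<F> R\<^sub>x f x0"
    and "\<forall>i\<in>{0..N}. f' i \<in> subdifferential f (x i)"
    and "x 0 = x0"
    and "\<forall>i\<in>{1..N}. x i = x0 - (\<Sum>j\<in>{1..<i}. (\<gamma> i j / \<gamma> i i) *\<^sub>R (x j - x0))
                           - (\<Sum>j\<in>{0..<i}. (\<beta> i j / \<gamma> i i) *\<^sub>R f' j)"
  shows "f (x N) - min_value f \<le> ereal \<omega>"
proof -
  have fF: "f \<in> \<F>" using assms(8) by (simp add: is_input_def)
  then have proper: "proper_fun f" using assms(3) by blast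
  obtain xs where xs: "xs \<in> argmin f" and dist: "norm (x0 - xs) \<le> R\<^sub>x"
    using assms(8) by (auto simp: is_input_def)
  define X where "X = case_idx xs x"
  define g where "g = case_idx 0 f'"
  define fv where "fv i = real_of_ereal (f (X i))" for i
  have X: "X Star = xs" "X (It i) = x i" and g: "g Star = 0" "g (It i) = f' i" for i
    by (simp_all add: X_def g_def)
  have sub: "g i \<in> subdifferential f (X i)" if "i \<in> idx_set N" for i
    using that assms(9) argmin_min_value(2)[OF xs] by (auto simp: idx_set_def X g)
  have fv: "ereal (fv i) = f (X i)" if "i \<in> idx_set N" for i
    using subdifferential_finite[OF proper sub[OF that]] by (simp add: fv_def ereal_real)
  have interp: "interpolable \<F> (idx_set N) X g fv"
    unfolding interpolable_def using fF sub fv by blast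
  have "finite K"
    and A: "\<And>k. k \<in> K \<Longrightarrow> A k \<in> carrier_mat (2*N+2) (2*N+2)"
    and a: "\<And>k. k \<in> K \<Longrightarrow> a k \<in> carrier_vec (N+2)"
    using assms(4) by (simp_all add: encodes_interpolation_def)
  moreover have "mat_trace (A k * gram (P_cols N X g)) + a k \<bullet> F_vec N fv + b k \<le> 0"
    if "k \<in> K" for k
    using assms(4) interp g(1) that unfolding encodes_interpolation_def by blast
  moreover have "inner (g (It i)) ((\<Sum>j\<in>{0..<i}. \<beta> i j *\<^sub>R g (It j))
        + (\<Sum>j\<in>{1..i}. \<gamma> i j *\<^sub>R (X (It j) - X (It 0)))) = 0" if "i \<in> {1..N}" for i
    using update_rule_imp_zero[of i "\<gamma> i" x "\<beta> i" f'] that assms(7,10,11) by (simp add: X g)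
  moreover have "norm (X (It 0) - X Star) \<le> R\<^sub>x"
    using dist assms(10) by (simp add: X)
  ultimately have "fv (It N) - fv Star \<le> D_objective R\<^sub>x K b \<alpha> \<tau>"
    using assms(5) by (intro D_feasible_bound[where x = X and g = g and A = A and a = a])
  moreover have "ereal (fv (It N)) = f (x N)" "ereal (fv Star) = min_value f"
    using fv[of "It N"] fv[of Star] argmin_min_value(1)[OF xs] by (simp_all add: idx_set_def X)
  ultimately show ?thesis
    using assms(6) by (metis ereal_less_eq(3) ereal_minus(1))
qed

end
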